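(* For all $a,c,q\in\mathbb{C}$ with $c\neq 0$, and all integers $n\geq 1$, one has, with $b=c^2$, the identity (of polynomials in $x$) $$p_{n}(x|q,a,b)=\sum_{k=1}^{n}\begin{bmatrix} n\\ k\end{bmatrix}_{q}c^{n-k}\,B_{n-k}\!\left(\tfrac{a}{c}\Big|q\right)\left(H_{k}(x|q)-c^{k}H_{k}\!\left(\tfrac{a}{c}\Big|q\right)\right).$$
   Context: Notation: $[n]_q=1+q+\dots+q^{n-1}$, $[0]_q=0$; $[n]_q!=[1]_q[2]_q\cdots[n]_q$, $[0]_q!=1$; $\begin{bmatrix} n\\ k\end{bmatrix}_q=\frac{[n]_q!}{[n-k]_q!\,[k]_q!}$, which is a polynomial in $q$ and is understood as such (so it is defined for every $q\in\mathbb{C}$). The convention $q^0=1$ is used also for $q=0$. The (renormalized) Al-Salam--Chihara polynomials $p_n(x)=p_n(x|q,a,b)$ are defined by $p_{-1}(x)=0$, $p_0(x)=1$ and $$p_{n+1}(x)=(x-aq^n)p_n(x)-(1-bq^{n-1})[n]_q\,p_{n-1}(x)\quad(n\ge 0).$$ The (renormalized) continuous $q$-Hermite polynomials are $H_n(x|q)=p_n(x|q,0,0)$, i.e. $H_{-1}=0$, $H_0=1$, $H_{n+1}(x)=xH_n(x)-[n]_qH_{n-1}(x)$ for $n\ge0$. The polynomials $B_n(x|q)$ are defined by $B_{-1}=0$, $B_0=1$ and $$B_{n+1}(x)=-q^nxB_n(x)+q^{n-1}[n]_qB_{n-1}(x)\quad(n\ge0).$$ In these recurrences the terms containing the factor $[n]_q$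 vanish for $n=0$. *)

theory Defs
  imports Complex_Main "HOL-Computational_Algebra.Polynomial"
begin

definition q_int :: "'a::comm_ring_1 \<Rightarrow> nat \<Rightarrow> 'a" where
  "q_int q n = (\<Sum>i<n. q ^ i)"

definition q_fact :: "'a::comm_ring_1 \<Rightarrow> nat \<Rightarrow> 'a" where
  "q_fact q n = (\<Prod>i=1..n. q_int q i)"

text \<open>
  The Gaussian binomial is a polynomial in the indeterminate, so that it can be evaluated also where
  the denominator vanishes (at roots of unity). The division in \<open>q_binomial_poly\<close> is the one of
  polynomials over a field; it is exact by \<open>q_fact_mult_dvd\<close> below.
\<close>

definition q_binomial_poly :: "nat \<Rightarrow> nat \<Rightarrow> complex poly" where
  "q_binomial_poly n k =
     (if k \<le> n then q_fact [:0, 1:] n div (q_fact [:0, 1:] (n - k) * q_fact [:0, 1:] k) else 0)"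

definition q_binomial :: "complex \<Rightarrow> nat \<Rightarrow> nat \<Rightarrow> complex" where
  "q_binomial q n k = poly (q_binomial_poly n k) q"

text \<open>
  The recurrences for \<open>n = 0\<close>, where the factor \<open>[0]\<^sub>q\<close> kills the term with \<open>q\<^sup>-\<^sup>1\<close> and the
  polynomial of index \<open>-1\<close>, give the equations for \<open>Suc 0\<close>.
\<close>

fun al_salam_chihara :: "complex \<Rightarrow> complex \<Rightarrow> complex \<Rightarrow> nat \<Rightarrow> complex poly" where
  "al_salam_chihara q a b 0 = 1"
| "al_salam_chihara q a b (Suc 0) = [:- a, 1:]"
| "al_salam_chihara q a b (Suc (Suc n)) =
     [:- (a * q ^ Suc n), 1:] * al_salam_chihara q a b (Suc n)
     - smult ((1 - b * q ^ n) * q_int q (Suc n)) (al_salam_chihara q a b n)"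

definition q_hermite :: "complex \<Rightarrow> nat \<Rightarrow> complex poly" where
  "q_hermite q n = al_salam_chihara q 0 0 n"

fun B_poly :: "complex \<Rightarrow> nat \<Rightarrow> complex poly" where
  "B_poly q 0 = 1"
| "B_poly q (Suc 0) = [:0, - 1:]"
| "B_poly q (Suc (Suc n)) =
     [:0, - (q ^ Suc n):] * B_poly q (Suc n)
     + smult (q ^ n * q_int q (Suc n)) (B_poly q n)"

lemma q_hermite_rec:
  "q_hermite q 0 = 1"
  "q_hermite q (Suc 0) = [:0, 1:]"
  "q_hermite q (Suc (Suc n)) =
     [:0, 1:] * q_hermite q (Suc n) - smult (q_int q (Suc n)) (q_hermite q n)"
  by (simp_all add: q_hermite_def)

lemma q_int_add: "q_int q (m + k) = q_int q m + q ^ m * q_int q k"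
  by (induction k) (simp_all add: q_int_def algebra_simps power_add)

lemma q_fact_Suc: "q_fact q (Suc n) = q_int q (Suc n) * q_fact q n"
  by (simp add: q_fact_def prod.nat_ivl_Suc' mult.commute)

lemma q_fact_mult_dvd_add: "q_fact q m * q_fact q k dvd q_fact q (m + k)"
proof (induction "m + k" arbitrary: m k)
  case 0
  then show ?case by (simp add: q_fact_def)
next
  case (Suc s)
  show ?case
  proof (cases "m = 0 \<or> k = 0")
    case True
    then show ?thesis by (auto simp: q_fact_def)
  next
    case False
    then obtain m' k' where mk: "m = Suc m'" "k = Suc k'"
      by (meson not0_implies_Suc)
    have "q_fact q m' * q_fact q k dvd q_fact q (m' + k)"
      and "q_fact q m * q_fact q k' dvd q_fact q (m + k')"
      using Suc.hyps(1)[of m' k] Suc.hyps(1)[of m k'] Suc.hyps(2) mk by auto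
    then have 1: "q_int q m * (q_fact q m' * q_fact q k) dvd q_int q m * q_fact q (m' + k)"
      and 2: "q_int q k * (q_fact q m * q_fact q k') dvd q_int q k * q_fact q (m + k')"
      by (auto intro: mult_dvd_mono)
    have "q_int q m * (q_fact q m' * q_fact q k) = q_fact q m * q_fact q k"
      "q_int q k * (q_fact q m * q_fact q k') = q_fact q m * q_fact q k"
      using q_fact_Suc[of q m'] q_fact_Suc[of q k'] mk by (simp_all add: mult_ac)
    moreover have "q_fact q (m + k) =
        q_int q m * q_fact q (m' + k) + q ^ m * (q_int q k * q_fact q (m + k'))"
    proof -
      have "q_fact q (m + k) = (q_int q m + q ^ m * q_int q k) * q_fact q (m' + k)"
        using q_fact_Suc[of q "m' + k"] q_int_add[of q m k] mk by simp
      moreover have "m + k' = m' + k" using mk by simp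
      ultimately show ?thesis by (simp only: distrib_right mult.assoc)
    qed
    ultimately show ?thesis using 1 2 by (simp add: dvd_add dvd_mult)
  qed
qed

lemma q_fact_mult_dvd:
  assumes "k \<le> n"
  shows "q_fact q (n - k) * q_fact q k dvd q_fact q n"
  using q_fact_mult_dvd_add[of q "n - k" k] assms by simp

end

theory Submission
  imports Defs
begin

text \<open>
  Put \<open>d\<^sub>m = c\<^sup>m B\<^sub>m(a/c)\<close>, so that \<open>d\<^sub>m\<^sub>+\<^sub>1 = - a q\<^sup>m d\<^sub>m + b q\<^sup>m\<^sup>-\<^sup>1 [m]\<^sub>q d\<^sub>m\<^sub>-\<^sub>1\<close>. Comparing coefficients of the
  \<open>q\<close>-Hermite polynomials, the absorption and Pascal rules for Gaussian binomials show that
  \<open>\<Sum>\<^sub>k [n,k]\<^sub>q d\<^sub>n\<^sub>-\<^sub>k H\<^sub>k(x)\<close>, with \<open>k\<close> from \<open>0\<close> to \<open>n\<close>, satisfies the recurrence of \<open>p\<^sub>n(x|q,a,b)\<close>. Applied to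
  \<open>p\<^sub>n(y|q,y,1)\<close>, which vanishes for \<open>n \<ge> 1\<close>, this gives \<open>\<Sum>\<^sub>k [n,k]\<^sub>q B\<^sub>n\<^sub>-\<^sub>k(y) H\<^sub>k(y) = 0\<close>. With \<open>y = a/c\<close>,
  \<open>c\<^sup>n\<close> times the latter identity may be subtracted, which removes the term \<open>k = 0\<close>.
\<close>

lemma smult_sum_right: "smult c (\<Sum>k\<in>A. f k) = (\<Sum>k\<in>A. smult c (f k))"
  by (induction A rule: infinite_finite_induct) (simp_all add: smult_add_right)

lemma poly_q_int: "poly (q_int p n) x = q_int (poly p x) n"
  by (simp add: q_int_def poly_sum)

text \<open>Its value at 1 is n + 1, nonzero in characteristic 0. This permits cancellation over the
  indeterminate, where specific roots of unity q would forbid it.\<close>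

lemma q_int_X_neq_0: "q_int [:0, 1::complex:] (Suc n) \<noteq> 0"
proof
  assume "q_int [:0, 1::complex:] (Suc n) = 0"
  then have "poly (q_int [:0, 1::complex:] (Suc n)) 1 = 0" by simp
  then have "of_nat (Suc n) = (0::complex)" by (simp only: poly_q_int) (simp add: q_int_def)
  then show False by (simp only: of_nat_eq_0_iff)
qed

lemma q_fact_X_neq_0: "q_fact [:0, 1::complex:] n \<noteq> 0"
  by (induction n) (simp_all add: q_fact_Suc q_int_X_neq_0, simp add: q_fact_def)

lemma q_binomial_poly_mult:
  assumes "k \<le> n"
  shows "q_binomial_poly n k * (q_fact [:0, 1:] (n - k) * q_fact [:0, 1:] k) = q_fact [:0, 1:] n"
  using q_fact_mult_dvd[OF assms, of "[:0, 1::complex:]"] assms by (simp add: q_binomial_poly_def)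

text \<open>Multiplied by [n-k]! [k]!, both sides become [n+1]!; the factorials then cancel in the
  polynomial ring.\<close>

lemma q_binomial_poly_absorb:
  "q_int [:0, 1:] (Suc k) * q_binomial_poly (Suc n) (Suc k) =
   q_int [:0, 1:] (Suc n) * q_binomial_poly n k"
proof (cases "k \<le> n")
  case True
  let ?f = "q_fact [:0, 1::complex:]"
  have "q_int [:0, 1:] (Suc k) * q_binomial_poly (Suc n) (Suc k) * (?f (n - k) * ?f k) =
      q_int [:0, 1:] (Suc n) * q_binomial_poly n k * (?f (n - k) * ?f k)"
    using q_binomial_poly_mult[of k n] q_binomial_poly_mult[of "Suc k" "Suc n"] True
    by (simp add: q_fact_Suc mult_ac)
  then show ?thesis by (simp add: q_fact_X_neq_0)
qed (simp add: q_binomial_poly_def)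

lemma q_binomial_poly_absorb_comp:
  "q_int [:0, 1:] (Suc n - k) * q_binomial_poly (Suc n) k =
   q_int [:0, 1:] (Suc n) * q_binomial_poly n k"
proof (cases "k \<le> n")
  case True
  let ?f = "q_fact [:0, 1::complex:]"
  have "q_int [:0, 1:] (Suc n - k) * q_binomial_poly (Suc n) k * (?f (n - k) * ?f k) =
      q_int [:0, 1:] (Suc n) * q_binomial_poly n k * (?f (n - k) * ?f k)"
    using q_binomial_poly_mult[of k n] q_binomial_poly_mult[of k "Suc n"] True
    by (simp add: Suc_diff_le q_fact_Suc mult_ac)
  then show ?thesis by (simp add: q_fact_X_neq_0)
qed (cases "k = Suc n"; simp add: q_binomial_poly_def q_int_def)

text \<open>Split [n+1] = [k+1] + q^(k+1) [n-k]. The two absorption rules turn each summand times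
  the binomial into a multiple of [n+1], which is cancelled.\<close>

lemma q_binomial_poly_Suc_Suc:
  "q_binomial_poly (Suc n) (Suc k) = [:0, 1:] ^ Suc k * q_binomial_poly n (Suc k) + q_binomial_poly n k"
proof (cases "k \<le> n")
  case True
  let ?i = "q_int [:0, 1::complex:]"
  have "?i (Suc n) = ?i (Suc k) + [:0, 1:] ^ Suc k * ?i (n - k)"
    using q_int_add[of "[:0, 1::complex:]" "Suc k" "n - k"] True by simp
  then have "?i (Suc n) * q_binomial_poly (Suc n) (Suc k) =
      ?i (Suc k) * q_binomial_poly (Suc n) (Suc k)
      + [:0, 1:] ^ Suc k * (?i (Suc n - Suc k) * q_binomial_poly (Suc n) (Suc k))"
    by (simp only: distrib_right mult.assoc diff_Suc_Suc)
  also have "\<dots> = ?i (Suc n) *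
      ([:0, 1:] ^ Suc k * q_binomial_poly n (Suc k) + q_binomial_poly n k)"
    by (simp only: q_binomial_poly_absorb q_binomial_poly_absorb_comp)
       (simp only: distrib_left mult_ac add_ac)
  finally show ?thesis using q_int_X_neq_0[of n] by (simp only: mult_cancel_left) simp
qed (simp add: q_binomial_poly_def)

lemma q_binomial_0_right [simp]: "q_binomial q n 0 = 1"
  using q_fact_X_neq_0[of n] by (simp add: q_binomial_def q_binomial_poly_def q_fact_def)

lemma q_binomial_eq_0: "n < k \<Longrightarrow> q_binomial q n k = 0"
  by (simp add: q_binomial_def q_binomial_poly_def)

lemma q_binomial_absorb:
  "q_int q (Suc k) * q_binomial q (Suc n) (Suc k) = q_int q (Suc n) * q_binomial q n k"
  using arg_cong[OF q_binomial_poly_absorb[of k n], of "\<lambda>p. poly p q"]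
  by (simp add: q_binomial_def poly_q_int)

lemma q_binomial_absorb_comp:
  "q_int q (Suc n - k) * q_binomial q (Suc n) k = q_int q (Suc n) * q_binomial q n k"
  using arg_cong[OF q_binomial_poly_absorb_comp[of n k], of "\<lambda>p. poly p q"]
  by (simp add: q_binomial_def poly_q_int)

lemma q_binomial_Suc_Suc:
  "q_binomial q (Suc n) (Suc k) = q ^ Suc k * q_binomial q n (Suc k) + q_binomial q n k"
  by (simp add: q_binomial_def q_binomial_poly_Suc_Suc)

text \<open>Covers k = 0 too: there [0]_q = 0 hides the truncated index
  \<open>k - 1\<close>.\<close>

lemma X_mult_q_hermite:
  "[:0, 1:] * q_hermite q k = q_hermite q (Suc k) + smult (q_int q k) (q_hermite q (k - 1))"
  by (cases k) (simp_all add: q_hermite_rec q_int_def)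

lemma al_salam_chihara_q_hermite:
  fixes d :: "nat \<Rightarrow> complex"
  assumes d: "d 0 = 1" "d (Suc 0) = - a"
    "\<And>m. d (Suc (Suc m)) = - (a * q ^ Suc m) * d (Suc m) + b * q ^ m * q_int q (Suc m) * d m"
  shows "al_salam_chihara q a b n = (\<Sum>k\<le>n. smult (q_binomial q n k * d (n - k)) (q_hermite q k))"
proof -
  define S where "S n = (\<Sum>k\<le>n. smult (q_binomial q n k * d (n - k)) (q_hermite q k))" for n
  let ?H = "q_hermite q"
  have S_0: "S 0 = 1" and S_1: "S (Suc 0) = [:- a, 1:]"
    using q_binomial_Suc_Suc[of q 0 0]
    by (simp_all add: S_def d q_hermite_rec q_binomial_eq_0)
  have S_rec: "S (Suc (Suc n)) = [:- (a * q ^ Suc n), 1:] * S (Suc n)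
      - smult ((1 - b * q ^ n) * q_int q (Suc n)) (S n)" for n
  proof -
    \<comment> \<open>U and V are the two halves of \<open>S (Suc (Suc n))\<close> under Pascal's
      rule. U is also the index-raising part of x S_(n+1), so only V remains to be matched.\<close>
    define U where "U = (\<Sum>k\<le>Suc n. smult (q_binomial q (Suc n) k * d (Suc n - k)) (?H (Suc k)))"
    define V where "V = (\<Sum>k\<le>Suc n. smult (q ^ k * q_binomial q (Suc n) k * d (Suc (Suc n) - k)) (?H k))"
    have "[:0, 1:] * S (Suc n) =
        (\<Sum>k\<le>Suc n. smult (q_binomial q (Suc n) k * d (Suc n - k)) ([:0, 1:] * ?H k))"
      unfolding S_def sum_distrib_left by (simp only: mult_smult_right)
    also have "\<dots> = U + (\<Sum>k\<le>Suc n. smult (q_int q k * q_binomial q (Suc n) k * d (Suc n - k)) (?H (k - 1)))"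
      unfolding U_def sum.distrib[symmetric]
      by (simp only: X_mult_q_hermite smult_add_right smult_smult) (simp only: mult_ac)
    \<comment> \<open>The factor [0]_q removes k = 0; after the shift, absorption applies.\<close>
    also have "(\<Sum>k\<le>Suc n. smult (q_int q k * q_binomial q (Suc n) k * d (Suc n - k)) (?H (k - 1)))
        = (\<Sum>k\<le>n. smult (q_int q (Suc n) * q_binomial q n k * d (n - k)) (?H k))"
      unfolding sum.atMost_Suc_shift by (simp add: q_binomial_absorb q_int_def[of q 0])
    also have "\<dots> = smult (q_int q (Suc n)) (S n)"
      by (simp add: S_def smult_sum_right mult.assoc)
    finally have X: "[:0, 1:] * S (Suc n) = U + smult (q_int q (Suc n)) (S n)" .
    have "S (Suc (Suc n)) = smult (d (Suc (Suc n))) (?H 0) +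
        (\<Sum>k\<le>Suc n. smult (q_binomial q (Suc (Suc n)) (Suc k) * d (Suc n - k)) (?H (Suc k)))"
      unfolding S_def by (subst sum.atMost_Suc_shift) simp
    also have "\<dots> = U + (smult (d (Suc (Suc n))) (?H 0) +
        (\<Sum>k\<le>Suc n. smult (q ^ Suc k * q_binomial q (Suc n) (Suc k) * d (Suc n - k)) (?H (Suc k))))"
      unfolding U_def
      by (simp only: q_binomial_Suc_Suc[of q "Suc n"] distrib_right smult_add_left sum.distrib add_ac)
    \<comment> \<open>The isolated summand is the term k = 0 of the shifted sum.\<close>
    also have "smult (d (Suc (Suc n))) (?H 0) +
        (\<Sum>k\<le>Suc n. smult (q ^ Suc k * q_binomial q (Suc n) (Suc k) * d (Suc n - k)) (?H (Suc k)))
        = (\<Sum>k\<le>Suc (Suc n). smult (q ^ k * q_binomial q (Suc n) k * d (Suc (Suc n) - k)) (?H k))"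
      by (subst (2) sum.atMost_Suc_shift) simp
    also have "\<dots> = V"
      unfolding V_def by (simp add: q_binomial_eq_0)
    finally have S_UV: "S (Suc (Suc n)) = U + V" .
    \<comment> \<open>For n = k + m this is the recurrence of d at m + 2: q^k completes the powers
      of q, and absorption rewrites [m+1]. At k = n + 1 only \<open>d (Suc 0) = - a\<close> is left,
      since the other binomial is 0.\<close>
    have coeff: "q ^ k * q_binomial q (Suc n) k * d (Suc (Suc n) - k) =
        - (a * q ^ Suc n) * (q_binomial q (Suc n) k * d (Suc n - k))
        + b * q ^ n * q_int q (Suc n) * (q_binomial q n k * d (n - k))" if k: "k \<le> Suc n" for k
    proof (cases "k = Suc n")
      case True
      then show ?thesis by (simp add: d q_binomial_eq_0)
    next
      case False
      then obtain m where m: "n = k + m" using k by (metis le_Suc_eq nat_le_iff_add)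
      have absorb: "q_int q (Suc m) * q_binomial q (Suc n) k = q_int q (Suc n) * q_binomial q n k"
        using q_binomial_absorb_comp[of q n k] m by (simp add: Suc_diff_le)
      have diff: "Suc (Suc n) - k = Suc (Suc m)" "Suc n - k = Suc m" "n - k = m"
        using m by simp_all
      have "q ^ k * q_binomial q (Suc n) k * d (Suc (Suc m)) =
          - (a * (q ^ k * q ^ Suc m)) * (q_binomial q (Suc n) k * d (Suc m))
          + b * (q ^ k * q ^ m) * (q_int q (Suc m) * q_binomial q (Suc n) k) * d m"
        by (simp add: d algebra_simps)
      also have "q ^ k * q ^ Suc m = q ^ Suc n"
        using m by (simp add: power_add)
      also have "q ^ k * q ^ m = q ^ n"
        using m by (simp add: power_add)
      finally show ?thesis
        unfolding absorb diff by (simp only: mult.assoc)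
    qed
    have "V = (\<Sum>k\<le>Suc n. smult (- (a * q ^ Suc n) * (q_binomial q (Suc n) k * d (Suc n - k))
        + b * q ^ n * q_int q (Suc n) * (q_binomial q n k * d (n - k))) (?H k))"
      unfolding V_def by (intro sum.cong refl) (simp only: coeff atMost_iff)
    also have "\<dots> = smult (- (a * q ^ Suc n)) (S (Suc n)) + smult (b * q ^ n * q_int q (Suc n))
        (\<Sum>k\<le>Suc n. smult (q_binomial q n k * d (n - k)) (?H k))"
      unfolding S_def by (simp only: smult_sum_right smult_smult smult_add_left sum.distrib)
    also have "(\<Sum>k\<le>Suc n. smult (q_binomial q n k * d (n - k)) (?H k)) = S n"
      by (simp add: S_def q_binomial_eq_0)
    finally have V: "V = smult (- (a * q ^ Suc n)) (S (Suc n)) + smult (b * q ^ n * q_int q (Suc n)) (S n)" .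
    have "[:- (a * q ^ Suc n), 1:] * S (Suc n) = smult (- (a * q ^ Suc n)) (S (Suc n)) + [:0, 1:] * S (Suc n)"
      by simp
    then show ?thesis
      unfolding S_UV V X by (simp add: algebra_simps smult_add_left smult_diff_left)
  qed
  have "al_salam_chihara q a b n = S n"
    by (induction n rule: induct_nat_012)
       (simp_all only: al_salam_chihara.simps S_0 S_1 S_rec)
  then show ?thesis by (simp add: S_def)
qed

lemma al_salam_chihara_B_poly:
  assumes "c \<noteq> 0"
  shows "al_salam_chihara q a (c ^ 2) n =
    (\<Sum>k\<le>n. smult (q_binomial q n k * (c ^ (n - k) * poly (B_poly q (n - k)) (a / c))) (q_hermite q k))"
  by (rule al_salam_chihara_q_hermite)
     (use assms in \<open>simp_all add: field_simps power2_eq_square\<close>)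

text \<open>At x = y the first polynomial x - y vanishes. In the next one 1 - b q^0 = 0 kills the
  term with p_0 = 1; from then on both preceding values are 0.\<close>

lemma poly_al_salam_chihara_1_eq_0: "poly (al_salam_chihara q y 1 (Suc n)) y = 0"
proof (induction n rule: induct_nat_012)
  case (ge2 n)
  then show ?case
    by (simp only: al_salam_chihara.simps(3)[of q y 1 "Suc n"] poly_diff poly_mult poly_smult) simp
qed simp_all

lemma sum_B_poly_q_hermite_eq_0:
  assumes "n \<ge> 1"
  shows "(\<Sum>k\<le>n. q_binomial q n k * poly (B_poly q (n - k)) y * poly (q_hermite q k) y) = 0"
  using al_salam_chihara_B_poly[of 1 q y n] poly_al_salam_chihara_1_eq_0[of q y "n - 1"] assms
  by (simp add: poly_sum)

theorem theorem1:
  fixes a b c q :: complex and n :: nat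
  assumes "c \<noteq> 0" and "n \<ge> 1" and "b = c ^ 2"
  shows "al_salam_chihara q a b n =
    (\<Sum>k=1..n. smult (q_binomial q n k * c ^ (n - k) * poly (B_poly q (n - k)) (a / c))
       (q_hermite q k - [:c ^ k * poly (q_hermite q k) (a / c):]))"
proof -
  let ?w = "\<lambda>k. q_binomial q n k * c ^ (n - k) * poly (B_poly q (n - k)) (a / c)"
  let ?h = "\<lambda>k. c ^ k * poly (q_hermite q k) (a / c)"
  have "(\<Sum>k\<le>n. ?w k * ?h k) = (\<Sum>k\<le>n. c ^ n *
      (q_binomial q n k * poly (B_poly q (n - k)) (a / c) * poly (q_hermite q k) (a / c)))"
  proof (intro sum.cong refl)
    fix k assume "k \<in> {..n}"
    then have "c ^ n = c ^ (n - k) * c ^ k" by (simp flip: power_add)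
    then show "?w k * ?h k = c ^ n *
        (q_binomial q n k * poly (B_poly q (n - k)) (a / c) * poly (q_hermite q k) (a / c))"
      by simp
  qed
  also have "\<dots> = 0"
    unfolding sum_distrib_left[symmetric] using assms by (simp add: sum_B_poly_q_hermite_eq_0)
  \<comment> \<open>As constant polynomials, these terms can be subtracted inside the expansion of
    p_n.\<close>
  finally have "(\<Sum>k\<le>n. [:?w k * ?h k:]) = 0"
    by (simp add: sum_to_poly)
  then have "al_salam_chihara q a b n = (\<Sum>k\<le>n. smult (?w k) (q_hermite q k - [:?h k:]))"
    using al_salam_chihara_B_poly[OF assms(1), of q a n] assms(3)
    by (simp add: smult_diff_right sum_subtractf mult.assoc)
  \<comment> \<open>The term k = 0 drops out because H_0 - c^0 H_0(a/c) = 1 - 1.\<close>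
  also have "{..n} = insert 0 {1..n}" by auto
  also have "(\<Sum>k\<in>insert 0 {1..n}. smult (?w k) (q_hermite q k - [:?h k:])) =
      (\<Sum>k=1..n. smult (?w k) (q_hermite q k - [:?h k:]))"
    by (subst sum.insert) (simp_all add: q_hermite_rec one_pCons)
  finally show ?thesis .
qed

end
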